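(* Let $\mathcal{H}$ be a real Hilbert space, $\mathcal{A}:\mathcal{H}\to2^{\mathcal{H}}$, $\mathcal{B}:\mathcal{H}\to\mathcal{H}$, and let $\mathcal{Q},\mathcal{M}:\mathcal{H}\to\mathcal{H}$ be bounded linear operators ($\mathcal{Q}$ not necessarily self-adjoint) such that: (1) $\mathcal{A}$ is maximally monotone; (2) $\mathcal{B}$ is $\beta^{-1}$-cocoercive with $\beta\in[0,+\infty[$, and $\mathrm{ran}\,\mathcal{B}\subseteq\mathrm{ran}\,\mathcal{Q}$; (3) $\mathcal{M}$ is invertible; (4) $\mathcal{S}:=\mathcal{Q}\mathcal{M}^{-1}$ is self-adjoint positive semi-definite with $\ker\mathcal{S}\setminus\{0\}\neq\emptyset$; (5) $\tilde{\mathcal{Q}}:=\frac12(\mathcal{Q}+\mathcal{Q}^\top)$ is at least degenerate, i.e. positive semi-definite; (6) $\tilde{\mathcal{Q}}$ has closed range, i.e. there is $\nu\in\,]0,+\infty[$ such that $\|\tilde{\mathcal{Q}}x\|\ge\nu\|x\|$ for all $x\in\mathrm{ran}\,\tilde{\mathcal{Q}}$ (fix such $\nu$); (7) $\mathcal{G}:=(1-\frac{\beta}{4\nu})(\mathcal{Q}+\mathcal{Q}^\top)-\mathcal{M}^\top\mathcal{Q}$ is self-adjoint positive semi-definite; (8) $\mathrm{ran}(\mathcal{A}+\mathcal{Q})\supseteq\mathrm{ran}(\mathcal{Q}-\mathcal{B})$ and $\mathrm{zer}(\mathcal{A}+\mathcal{B})\neq\emptyset$. Let $x^0\in\mathcal{H}$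 and let $\{x^k\}_{k\in\mathbb{N}}$ be generated by $$0\in\mathcal{A}\tilde{x}^k+\mathcal{B}x^k+\mathcal{Q}(\tilde{x}^k-x^k),\qquad x^{k+1}:=x^k+\mathcal{M}(\tilde{x}^k-x^k).$$ Suppose there exists $\eta\in\,]0,+\infty[$ such that $\|x^k-x^{k+1}\|^2_{\mathcal{M}^{-\top}\mathcal{G}\mathcal{M}^{-1}}\ge\eta\|x^k-x^{k+1}\|_{\mathcal{S}}^2$ for all $k\in\mathbb{N}$. Then: (i) There exists $x^\star\in\mathrm{zer}(\mathcal{A}+\mathcal{B})$ such that $\mathcal{S}x^k\rightharpoonup\mathcal{S}x^\star$ (weakly) as $k\to\infty$. (ii) For every $x^\star\in\mathrm{zer}(\mathcal{A}+\mathcal{B})$ and every $k\in\mathbb{N}$, $$\|x^{k+1}-x^k\|_{\mathcal{S}}\le\frac{1}{\sqrt{k+1}}\frac{1}{\sqrt{\eta}}\|x^0-x^\star\|_{\mathcal{S}}.$$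
   Context: ${}^\top$ denotes the adjoint and $\mathcal{M}^{-\top}=(\mathcal{M}^{-1})^\top$. For a self-adjoint positive semi-definite operator $\mathcal{P}$, $\|x\|_{\mathcal{P}}^2:=\langle\mathcal{P}x|x\rangle$ (a seminorm in general). $\mathrm{zer}(\mathcal{A}+\mathcal{B})=\{x:0\in\mathcal{A}x+\mathcal{B}x\}$. $\mathcal{B}$ is $\beta^{-1}$-cocoercive if $\langle x_1-x_2|\mathcal{B}x_1-\mathcal{B}x_2\rangle\ge\beta^{-1}\|\mathcal{B}x_1-\mathcal{B}x_2\|^2$ for all $x_1,x_2$; by convention the case $\beta=0$ means $\mathcal{B}=0$. *)

theory Defs
  imports "HOL-Analysis.Analysis"
begin

text \<open>
  A real Hilbert space is a type of sort \<open>{real_inner, banach}\<close>. A set-valued operator is a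
  function \<open>'a \<Rightarrow> 'a set\<close>; sums of sets are Minkowski sums (theory Set_Algebras), so that the
  sum of \<open>A\<close> and a single-valued operator \<open>F\<close> is \<open>\<lambda>x. A x + {F x}\<close>.
\<close>

definition op_zer :: "('a::zero \<Rightarrow> 'a set) \<Rightarrow> 'a set" where
  "op_zer A = {x. 0 \<in> A x}"

definition op_ran :: "('a \<Rightarrow> 'b set) \<Rightarrow> 'b set" where
  "op_ran A = (\<Union>x. A x)"

definition monotone_operator :: "('a::real_inner \<Rightarrow> 'a set) \<Rightarrow> bool" where
  "monotone_operator A \<longleftrightarrow>
     (\<forall>x y u v. u \<in> A x \<longrightarrow> v \<in> A y \<longrightarrow> inner (x - y) (u - v) \<ge> 0)"

definition maximally_monotone :: "('a::real_inner \<Rightarrow> 'a set) \<Rightarrow> bool" where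
  "maximally_monotone A \<longleftrightarrow> monotone_operator A \<and>
     (\<forall>A'. monotone_operator A' \<and> (\<forall>x. A x \<subseteq> A' x) \<longrightarrow> A' = A)"

definition cocoercive :: "real \<Rightarrow> ('a::real_inner \<Rightarrow> 'a) \<Rightarrow> bool" where
  "cocoercive c B \<longleftrightarrow>
     (\<forall>x y. inner (x - y) (B x - B y) \<ge> c * (norm (B x - B y))\<^sup>2)"

text \<open>
  \<open>inverse_cocoercive \<beta> B\<close> is \<open>\<beta>\<^sup>-\<^sup>1\<close>-cocoercivity with the convention that
  \<open>\<beta> = 0\<close> means \<open>B = 0\<close>; the case distinction is needed because \<open>inverse 0 = 0\<close> in HOL.
\<close>

definition inverse_cocoercive :: "real \<Rightarrow> ('a::real_inner \<Rightarrow> 'a) \<Rightarrow> bool" where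
  "inverse_cocoercive \<beta> B \<longleftrightarrow>
     (if \<beta> = 0 then B = (\<lambda>_. 0) else cocoercive (inverse \<beta>) B)"

definition invertible_operator :: "('a::real_normed_vector \<Rightarrow> 'a) \<Rightarrow> bool" where
  "invertible_operator M \<longleftrightarrow> bounded_linear M \<and> bij M \<and> bounded_linear (inv M)"

text \<open>
  The library's \<^const>\<open>adjoint\<close> is a choice among the maps \<open>f'\<close> with
  \<open>inner (f x) y = inner x (f' y)\<close>. For bounded linear \<open>f\<close> on a Hilbert space such a map exists
  (Riesz) and is unique, so it is the usual Hilbert space adjoint.
\<close>

definition self_adjoint :: "('a::real_inner \<Rightarrow> 'a) \<Rightarrow> bool" where
  "self_adjoint P \<longleftrightarrow> adjoint P = P"

definition positive_semidefinite :: "('a::real_inner \<Rightarrow> 'a) \<Rightarrow> bool" where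
  "positive_semidefinite P \<longleftrightarrow> (\<forall>x. inner (P x) x \<ge> 0)"

definition op_seminorm :: "('a::real_inner \<Rightarrow> 'a) \<Rightarrow> 'a \<Rightarrow> real" where
  "op_seminorm P x = sqrt (inner (P x) x)"

definition weakly_converges :: "(nat \<Rightarrow> 'a::real_inner) \<Rightarrow> 'a \<Rightarrow> bool" where
  "weakly_converges u l \<longleftrightarrow> (\<forall>y. (\<lambda>k. inner (u k) y) \<longlonglongrightarrow> inner l y)"

end

theory Submission
  imports Defs "HOL-Complex_Analysis.Great_Picard"
begin

text \<open>
  Write \<open>d = xt - x\<close>, so that one step is \<open>x + M d\<close>. Monotonicity of \<open>A\<close>, cocoercivity of \<open>B\<close> and
  the coercivity of \<open>Qt\<close> on the closure of its range make the step nonexpansive in the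
  \<open>S\<close>-seminorm, with gain given by the form of \<open>G\<close>. This gives Fejer monotonicity and monotone step lengths,
  hence the rate.

  Positivity of \<open>G = 2 (1 - \<beta> / (4 \<nu>)) Qt - M\<^sup>T S M\<close> forces \<open>Q\<close>, its adjoint, \<open>Qt\<close> and \<open>S\<close> to have one
  common kernel. So \<open>Q\<close> is bounded below on the orthogonal complement of that kernel, which makes
  \<open>range S = range Q\<close> closed: a weak cluster point of \<open>S (x k)\<close> is therefore some \<open>S u\<close>. The
  range condition provides a step from \<open>u\<close>, Opial's demiclosedness argument shows that its \<open>d\<close> lies in the
  kernel, and \<open>B\<close> does not see kernel directions, so \<open>u + d\<close> is a zero of \<open>A + B\<close> with the same
  image under \<open>S\<close>.
\<close>

section \<open>Hilbert space preliminaries\<close>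

lemma parallelogram_midpoint:
  fixes x a b :: "'a::real_inner"
  shows "(norm (a - b))\<^sup>2 = 2 * (norm (x - a))\<^sup>2 + 2 * (norm (x - b))\<^sup>2
           - 4 * (norm (x - (1/2) *\<^sub>R (a + b)))\<^sup>2"
  unfolding power2_norm_eq_inner
  by (simp add: inner_diff_left inner_diff_right inner_add_left inner_add_right inner_commute
      field_simps)

text \<open>A minimizing sequence is Cauchy by the parallelogram law; its limit lies in
  \<open>W\<close> by closedness.\<close>

lemma nearest_point_subspace_exists:
  fixes W :: "'a::{real_inner,banach} set"
  assumes W: "subspace W" and cl: "closed W"
  obtains w where "w \<in> W" "norm (x - w) = infdist x W"
proof -
  have ne: "W \<noteq> {}"
    using subspace_0[OF W] by auto
  define \<delta> where "\<delta> = infdist x W"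
  have \<delta>0: "0 \<le> \<delta>" by (simp add: \<delta>_def infdist_nonneg)
  have lower: "\<delta> \<le> norm (x - v)" if "v \<in> W" for v
    using infdist_le[OF that, of x] by (simp add: \<delta>_def dist_norm)
  have "\<exists>v\<in>W. norm (x - v) < \<delta> + 1 / (real n + 1)" for n :: nat
  proof (rule ccontr)
    assume "\<not> ?thesis"
    then have "\<delta> + 1 / (real n + 1) \<le> infdist x W"
      unfolding infdist_notempty[OF ne]
      by (intro cINF_greatest[OF ne]) (auto simp: dist_norm not_less)
    then show False by (simp add: \<delta>_def field_simps)
  qed
  then obtain w where w: "\<And>n. w n \<in> W" "\<And>n. norm (x - w n) < \<delta> + 1 / (real n + 1)"
    by metis
  have lim: "(\<lambda>n. norm (x - w n)) \<longlonglongrightarrow> \<delta>"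
  proof (rule tendsto_sandwich[where f = "\<lambda>_. \<delta>" and h = "\<lambda>n. \<delta> + 1 / (real n + 1)"])
    show "(\<lambda>n. \<delta> + 1 / (real n + 1)) \<longlonglongrightarrow> \<delta>"
      using LIMSEQ_inverse_real_of_nat_add[of \<delta>] by (simp add: inverse_eq_divide add.commute)
  qed (use lower w in \<open>auto intro!: always_eventually less_imp_le\<close>)
  \<comment> \<open>Midpoints stay in \<open>W\<close>, so they are no closer to \<open>x\<close>
    than \<delta>.\<close>
  have est: "(norm (w m - w n))\<^sup>2 \<le> 2 * (norm (x - w m))\<^sup>2 + 2 * (norm (x - w n))\<^sup>2 - 4 * \<delta>\<^sup>2" for m n
  proof -
    have "(1/2) *\<^sub>R (w m + w n) \<in> W"
      using w W by (intro subspace_scale subspace_add)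
    then have "\<delta>\<^sup>2 \<le> (norm (x - (1/2) *\<^sub>R (w m + w n)))\<^sup>2"
      using lower \<delta>0 by (intro power_mono)
    then show ?thesis
      using parallelogram_midpoint[of "w m" "w n" x] by linarith
  qed
  have "Cauchy w"
  proof (rule metric_CauchyI)
    fix e :: real assume e: "0 < e"
    have "(\<lambda>n. (norm (x - w n))\<^sup>2) \<longlonglongrightarrow> \<delta>\<^sup>2"
      by (intro tendsto_intros lim)
    \<comment> \<open>In \<open>est\<close> two errors below \<open>e\<^sup>2 / 4\<close>, each
      doubled, add up to less than \<open>e\<^sup>2\<close>.\<close>
    then obtain N where N: "\<And>n. n \<ge> N \<Longrightarrow> (norm (x - w n))\<^sup>2 < \<delta>\<^sup>2 + e\<^sup>2 / 4"
      using order_tendstoD(2)[of _ "\<delta>\<^sup>2" sequentially "\<delta>\<^sup>2 + e\<^sup>2/4"] e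
      by (auto simp: eventually_sequentially)
    have "dist (w m) (w n) < e" if "m \<ge> N" "n \<ge> N" for m n
    proof -
      have "(norm (w m - w n))\<^sup>2 < e\<^sup>2"
        using est[of m n] N[OF that(1)] N[OF that(2)] by linarith
      then show ?thesis
        using e power_less_imp_less_base[of _ 2 e] by (simp add: dist_norm)
    qed
    then show "\<exists>M. \<forall>m\<ge>M. \<forall>n\<ge>M. dist (w m) (w n) < e" by blast
  qed
  then obtain l where l: "w \<longlonglongrightarrow> l"
    using Cauchy_convergent_iff convergent_def by blast
  have "(\<lambda>n. norm (x - w n)) \<longlonglongrightarrow> norm (x - l)"
    by (intro tendsto_intros l)
  then have "norm (x - l) = \<delta>"
    using lim LIMSEQ_unique by blast
  moreover have "l \<in> W"
    using cl w(1) l closed_sequentially by blast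
  ultimately show ?thesis
    using that by (simp add: \<delta>_def)
qed

text \<open>The residual of the nearest point is orthogonal to \<open>W\<close>, since moving along
  a non-orthogonal \<open>v\<close> would shorten it.\<close>

lemma orthogonal_decomposition:
  fixes W :: "'a::{real_inner,banach} set"
  assumes W: "subspace W" and cl: "closed W"
  obtains w n where "x = w + n" "w \<in> W" "\<And>v. v \<in> W \<Longrightarrow> inner n v = 0"
proof -
  obtain w where w: "w \<in> W" "norm (x - w) = infdist x W"
    using nearest_point_subspace_exists[OF W cl] .
  have "inner (x - w) v = 0" if v: "v \<in> W" for v
  proof (cases "v = 0")
    case False
    then have vp: "0 < inner v v" by simp
    \<comment> \<open>The minimizer of the squared distance from \<open>x\<close> to
      \<open>w + t *\<^sub>R v\<close>.\<close>
    define t where "t = inner (x - w) v / inner v v"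
    have "w + t *\<^sub>R v \<in> W"
      using w v W by (intro subspace_add subspace_scale)
    then have "norm (x - w) \<le> norm (x - (w + t *\<^sub>R v))"
      using w(2) infdist_le[of "w + t *\<^sub>R v" W x] by (simp add: dist_norm)
    then have "inner (x - w) (x - w) \<le> inner (x - (w + t *\<^sub>R v)) (x - (w + t *\<^sub>R v))"
      by (simp add: norm_le)
    also have "\<dots> = inner (x - w) (x - w) - 2 * t * inner (x - w) v + t * t * inner v v"
      by (simp add: algebra_simps inner_commute)
    also have "\<dots> = inner (x - w) (x - w) - (inner (x - w) v)\<^sup>2 / inner v v"
      using vp by (simp add: t_def field_simps power2_eq_square)
    finally have "(inner (x - w) v)\<^sup>2 / inner v v \<le> 0" by simp
    then show ?thesis
      using vp by (simp add: divide_le_0_iff)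
  qed simp
  then show ?thesis
    using that[of w "x - w"] w(1) by simp
qed

text \<open>A nonzero functional is determined by its value at one vector \<open>n\<close> normal to
  its closed kernel, so a multiple of \<open>n\<close> represents it.\<close>

lemma riesz_representation:
  fixes f :: "'a::{real_inner,banach} \<Rightarrow> real"
  assumes f: "bounded_linear f"
  obtains z where "\<And>x. f x = inner z x"
proof (cases "\<forall>x. f x = 0")
  case True
  then show ?thesis using that[of 0] by simp
next
  case False
  then obtain x where x: "f x \<noteq> 0" by auto
  interpret f: bounded_linear f by fact
  have "subspace {y. f y = 0}"
    by (simp add: subspace_def f.add f.scaleR f.zero)
  moreover have "closed {y. f y = 0}"
    by (intro closed_Collect_eq f.continuous_on continuous_intros)
  ultimately obtain w n where wn: "x = w + n" "w \<in> {y. f y = 0}"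
      "\<And>v. v \<in> {y. f y = 0} \<Longrightarrow> inner n v = 0"
    using orthogonal_decomposition[of "{y. f y = 0}" x] by metis
  have fn: "f n \<noteq> 0" using wn x by (auto simp: f.add)
  then have n: "0 < inner n n" using f.zero by force
  have "f y = inner ((f n / inner n n) *\<^sub>R n) y" for y
  proof -
    have "f (y - (f y / f n) *\<^sub>R n) = 0"
      using fn by (simp add: f.diff f.scaleR)
    then have "inner n (y - (f y / f n) *\<^sub>R n) = 0"
      using wn(3) by simp
    then show ?thesis
      using fn n by (simp add: inner_diff_right field_simps)
  qed
  then show ?thesis using that by blast
qed

section \<open>Adjoints of bounded operators\<close>

text \<open>Riesz representation of \<open>\<lambda>x. inner (f x) y\<close> supplies a candidate
  for the choice in \<open>adjoint\<close>.\<close>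

lemma adjoint_works_hilbert:
  fixes f :: "'a::{real_inner,banach} \<Rightarrow> 'b::real_inner"
  assumes f: "bounded_linear f"
  shows "inner x (adjoint f y) = inner (f x) y"
proof -
  have "\<exists>z. \<forall>x. inner (f x) y = inner x z" for y
  proof -
    have "bounded_linear (\<lambda>x. inner (f x) y)"
      by (rule bounded_linear_compose[OF bounded_linear_inner_left f])
    then obtain z where "\<And>x. inner (f x) y = inner z x"
      by (rule riesz_representation) blast
    then show ?thesis by (auto simp: inner_commute)
  qed
  then have "\<exists>f'. \<forall>x y. inner (f x) y = inner x (f' y)"
    by metis
  then have "\<forall>x y. inner (f x) y = inner x (adjoint f y)"
    unfolding adjoint_def by (rule someI_ex)
  then show ?thesis by simp
qed

text \<open>Linearity follows by testing against all vectors, the bound by pairing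
  \<open>adjoint f y\<close> with itself.\<close>

lemma bounded_linear_adjoint_hilbert:
  fixes f :: "'a::{real_inner,banach} \<Rightarrow> 'b::real_inner"
  assumes f: "bounded_linear f"
  shows "bounded_linear (adjoint f)"
proof -
  note adj = adjoint_works_hilbert[OF f]
  obtain K where K: "0 \<le> K" "\<And>x. norm (f x) \<le> norm x * K"
    using bounded_linear.nonneg_bounded[OF f] by blast
  have eqI: "u = v" if "\<And>x. inner x u = inner x v" for u v :: 'a
    using that[of "u - v"] by (metis inner_diff_right inner_eq_zero_iff right_minus_eq)
  show ?thesis
  proof
    show "adjoint f (y + z) = adjoint f y + adjoint f z" for y z
      by (rule eqI) (simp add: adj inner_add_right)
    show "adjoint f (r *\<^sub>R y) = r *\<^sub>R adjoint f y" for r y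
      by (rule eqI) (simp add: adj)
    have "norm (adjoint f y) \<le> norm y * K" for y
    proof (cases "adjoint f y = 0")
      case False
      have "(norm (adjoint f y))\<^sup>2 = inner (f (adjoint f y)) y"
        by (simp add: power2_norm_eq_inner adj)
      also have "\<dots> \<le> norm (f (adjoint f y)) * norm y"
        by (rule norm_cauchy_schwarz)
      also have "\<dots> \<le> (norm (adjoint f y) * K) * norm y"
        by (intro mult_right_mono K) simp
      finally show ?thesis
        using False by (simp add: power2_eq_square mult.assoc mult.commute)
    qed (simp add: K)
    then show "\<exists>K. \<forall>y. norm (adjoint f y) \<le> norm y * K" by blast
  qed
qed

section \<open>Weak sequential compactness of bounded sequences\<close>

text \<open>No separability is assumed: it suffices to test against the closed span of the sequence
  itself, since vectors orthogonal to it give inner product zero. Riesz turns the limit functional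
  into a vector.\<close>

lemma bounded_weakly_convergent_subsequence:
  fixes u :: "nat \<Rightarrow> 'a::{real_inner,banach}"
  assumes C: "\<And>n. norm (u n) \<le> C"
  obtains r l where "strict_mono r" "weakly_converges (\<lambda>n. u (r n)) l"
proof -
  have C0: "0 \<le> C"
    using C[of 0] norm_ge_zero order_trans by blast
  have "norm (inner (u n) (u j)) \<le> C * C" for n j
  proof -
    have "norm (inner (u n) (u j)) \<le> norm (u n) * norm (u j)"
      by (simp add: Cauchy_Schwarz_ineq2)
    also have "\<dots> \<le> C * C"
      using C C0 by (intro mult_mono) auto
    finally show ?thesis .
  qed
  \<comment> \<open>Diagonal extraction over the countably many test vectors
    \<open>u j\<close>.\<close>
  then obtain r where r: "strict_mono (r :: nat \<Rightarrow> nat)"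
      and conv: "\<And>j. \<exists>l. (\<lambda>n. inner (u (r n)) (u j)) \<longlonglongrightarrow> l"
    using function_convergent_subsequence[of "UNIV :: nat set" "\<lambda>n j. inner (u n) (u j)" "C * C"]
    by (metis UNIV_I countableI_type)
  define V where "V = {y. convergent (\<lambda>n. inner (u (r n)) y)}"
  have V: "subspace V"
    by (auto simp: subspace_def V_def inner_add_right convergent_const
        intro: convergent_add convergent_mult convergent_const)
  have "closed V"
    unfolding closed_sequential_limits
  proof (intro allI impI)
    fix v y assume v: "(\<forall>n. v n \<in> V) \<and> v \<longlonglongrightarrow> y"
    have "Cauchy (\<lambda>n. inner (u (r n)) y)"
    proof (rule metric_CauchyI)
      fix e :: real assume e: "0 < e"
      \<comment> \<open>Replacing \<open>y\<close> by \<open>v k\<close> costs at most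
        \<open>e / 4\<close> at each of two indices; \<open>C + 1\<close> avoids division by
        zero.\<close>
      define d where "d = e / (4 * (C + 1))"
      have d: "0 < d" "C * d \<le> e / 4"
        using e C0 by (auto simp: d_def field_simps)
      obtain k where k: "norm (v k - y) < d"
        using v d LIMSEQ_D[of v y d] by blast
      have "Cauchy (\<lambda>n. inner (u (r n)) (v k))"
        using v by (auto simp: V_def Cauchy_convergent_iff)
      then obtain N where N: "\<And>m n. m \<ge> N \<Longrightarrow> n \<ge> N \<Longrightarrow>
          dist (inner (u (r m)) (v k)) (inner (u (r n)) (v k)) < e / 2"
        using e metric_CauchyD[of _ "e/2"] by (metis half_gt_zero)
      have near: "\<bar>inner (u (r n)) (v k - y)\<bar> \<le> e / 4" for n
      proof -
        have "\<bar>inner (u (r n)) (v k - y)\<bar> \<le> norm (u (r n)) * norm (v k - y)"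
          by (rule Cauchy_Schwarz_ineq2)
        also have "\<dots> \<le> C * d"
          using C C0 k by (intro mult_mono) auto
        finally show ?thesis using d by simp
      qed
      have "dist (inner (u (r m)) y) (inner (u (r n)) y) < e" if "m \<ge> N" "n \<ge> N" for m n
        using N[OF that] near[of m] near[of n]
        by (simp add: dist_real_def inner_diff_right abs_if split: if_splits)
      then show "\<exists>M. \<forall>m\<ge>M. \<forall>n\<ge>M. dist (inner (u (r m)) y) (inner (u (r n)) y) < e"
        by blast
    qed
    then show "y \<in> V" by (simp add: V_def Cauchy_convergent_iff)
  qed
  have uV: "u j \<in> V" for j
    using conv[of j] by (simp add: V_def convergent_def)
  have all: "convergent (\<lambda>n. inner (u (r n)) y)" for y
  proof -
    obtain w n where wn: "y = w + n" "w \<in> V" "\<And>v. v \<in> V \<Longrightarrow> inner n v = 0"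
      using orthogonal_decomposition[OF V \<open>closed V\<close>] by blast
    have "inner (u (r m)) y = inner (u (r m)) w" for m
      using wn(3)[OF uV[of "r m"]] by (simp add: wn(1) inner_add_left inner_add_right inner_commute)
    then show ?thesis using wn(2) by (simp add: V_def)
  qed
  define L where "L y = lim (\<lambda>n. inner (u (r n)) y)" for y
  have L: "(\<lambda>n. inner (u (r n)) y) \<longlonglongrightarrow> L y" for y
    using all[of y] by (simp add: L_def convergent_LIMSEQ_iff)
  have "bounded_linear L"
  proof
    show "L (a + b) = L a + L b" for a b
      using tendsto_add[OF L L, of a b] L[of "a + b"] LIMSEQ_unique by (simp add: inner_add_right)
    show "L (c *\<^sub>R a) = c *\<^sub>R L a" for c a
      using tendsto_mult_left[OF L, of c a] L[of "c *\<^sub>R a"] LIMSEQ_unique by simp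
    have "norm (L y) \<le> norm y * C" for y
    proof (rule LIMSEQ_le_const2)
      show "(\<lambda>n. norm (inner (u (r n)) y)) \<longlonglongrightarrow> norm (L y)"
        by (intro tendsto_intros L)
      have "norm (inner (u (r n)) y) \<le> norm y * C" for n
        using Cauchy_Schwarz_ineq2[of "u (r n)" y] mult_right_mono[OF C[of "r n"], of "norm y"]
        by (simp add: mult.commute)
      then show "\<exists>N. \<forall>n\<ge>N. norm (inner (u (r n)) y) \<le> norm y * C" by blast
    qed
    then show "\<exists>K. \<forall>y. norm (L y) \<le> norm y * K" by blast
  qed
  then obtain l where "\<And>y. L y = inner l y"
    by (rule riesz_representation) blast
  then show ?thesis
    using that[OF r, of l] L by (simp add: weakly_converges_def)
qed

section \<open>Closed ranges and weakly closed subspaces\<close>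

text \<open>The range is already the image of the orthogonal complement of the kernel, and a map
  bounded below sends a complete set to a complete set.\<close>

lemma closed_range_bounded_below:
  fixes f :: "'a::{real_inner,banach} \<Rightarrow> 'b::banach"
  assumes f: "bounded_linear f" and c: "0 < c"
    and below: "\<And>z. (\<And>n. f n = 0 \<Longrightarrow> inner z n = 0) \<Longrightarrow> c * norm z \<le> norm (f z)"
  shows "closed (range f)"
proof -
  interpret f: bounded_linear f by fact
  define K where "K = {y. f y = 0}"
  have K: "subspace K" "closed K"
    unfolding K_def
    by (auto simp: subspace_def f.add f.scaleR f.zero
        intro!: closed_Collect_eq f.continuous_on continuous_intros)
  define W where "W = {z. \<forall>n\<in>K. inner z n = 0}"
  have "subspace W"
    by (auto simp: W_def subspace_def inner_add_left)
  moreover have "closed W"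
    unfolding W_def Ball_def
    by (intro closed_Collect_all closed_Collect_imp closed_Collect_eq open_Collect_const continuous_intros)
  ultimately have "complete (f ` W)"
    using below c
    by (intro complete_isometric_image[OF c _ f]) (auto simp: W_def K_def complete_eq_closed)
  moreover have "range f = f ` W"
  proof -
    have "f y \<in> f ` W" for y
    proof -
      obtain n w where "y = n + w" "n \<in> K" "\<And>v. v \<in> K \<Longrightarrow> inner w v = 0"
        using orthogonal_decomposition[OF K] by metis
      then show ?thesis by (auto simp: W_def K_def f.add)
    qed
    then show ?thesis by blast
  qed
  ultimately show ?thesis by (simp add: complete_eq_closed)
qed

text \<open>Testing the convergence against the component of \<open>l\<close> orthogonal to
  \<open>W\<close> shows that this component vanishes.\<close>

lemma weakly_converges_subspace:
  fixes W :: "'a::{real_inner,banach} set"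
  assumes W: "subspace W" "closed W" and u: "weakly_converges u l" "\<And>n. u n \<in> W"
  shows "l \<in> W"
proof -
  obtain w n where wn: "l = w + n" "w \<in> W" "\<And>v. v \<in> W \<Longrightarrow> inner n v = 0"
    using orthogonal_decomposition[OF W] by metis
  have "(\<lambda>k. inner (u k) n) \<longlonglongrightarrow> inner l n"
    using u(1) by (simp add: weakly_converges_def)
  moreover have "inner (u k) n = 0" for k
    using wn(3)[OF u(2)] by (simp add: inner_commute)
  ultimately have "inner l n = 0"
    by (simp add: LIMSEQ_const_iff)
  then have "n = 0"
    using wn(3)[OF wn(2)] by (simp add: wn(1) inner_add_left inner_add_right inner_commute)
  then show ?thesis using wn by simp
qed

lemma subspace_closure:
  fixes W :: "'a::real_normed_vector set"
  assumes W: "subspace W"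
  shows "subspace (closure W)"
proof (rule subspaceI)
  show "0 \<in> closure W"
    using subspace_0[OF W] closure_subset by blast
next
  fix a b assume "a \<in> closure W" "b \<in> closure W"
  then obtain u v where "\<And>n. u n \<in> W" "u \<longlonglongrightarrow> a" "\<And>n. v n \<in> W" "v \<longlonglongrightarrow> b"
    by (auto simp: closure_sequential)
  then have "\<forall>n. u n + v n \<in> W" "(\<lambda>n. u n + v n) \<longlonglongrightarrow> a + b"
    using subspace_add[OF W] tendsto_add by blast+
  then show "a + b \<in> closure W"
    unfolding closure_sequential by (intro exI[of _ "\<lambda>n. u n + v n"]) simp
next
  fix c a assume "a \<in> closure W"
  then obtain u where "\<And>n. u n \<in> W" "u \<longlonglongrightarrow> a"
    by (auto simp: closure_sequential)
  then have "\<forall>n. c *\<^sub>R u n \<in> W" "(\<lambda>n. c *\<^sub>R u n) \<longlonglongrightarrow> c *\<^sub>R a"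
    using subspace_scale[OF W] tendsto_scaleR[OF tendsto_const] by blast+
  then show "c *\<^sub>R a \<in> closure W"
    unfolding closure_sequential by (intro exI[of _ "\<lambda>n. c *\<^sub>R u n"]) simp
qed

section \<open>Positive semidefinite operators\<close>

text \<open>Interpreted below for both \<open>S\<close> and \<open>Qt\<close>. The form
  \<open>q\<close> is the square of a seminorm only, so conclusions hold modulo the kernel of
  \<open>T\<close>.\<close>

locale psd_operator = bounded_linear T
  for T :: "'a::{real_inner,banach} \<Rightarrow> 'a" +
  assumes symmetric: "inner (T x) y = inner x (T y)"
    and nonneg: "0 \<le> inner (T x) x"
begin

abbreviation q :: "'a \<Rightarrow> real" where "q x \<equiv> inner (T x) x"

lemma q_add: "q (x + y) = q x + 2 * inner (T x) y + q y"
  using symmetric[of y x] by (simp add: add inner_add_left inner_add_right inner_commute)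

lemma q_diff: "q (x - y) = q x - 2 * inner (T x) y + q y"
  using symmetric[of y x] by (simp add: diff inner_diff_left inner_diff_right inner_commute)

lemma q_minus: "q (- x) = q x"
  by (simp add: neg)

lemma cauchy_schwarz: "(inner (T x) y)\<^sup>2 \<le> q x * q y"
proof -
  have expand: "0 \<le> q x - 2 * t * inner (T x) y + t * t * q y" for t
    using nonneg[of "x - t *\<^sub>R y"] unfolding q_diff by (simp add: scaleR)
  show ?thesis
  proof (cases "q y = 0")
    case True
    have "inner (T x) y = 0"
    proof (rule ccontr)
      assume "inner (T x) y \<noteq> 0"
      then show False
        \<comment> \<open>With \<open>q y = 0\<close> the expansion is affine in \<open>t\<close>;
          this \<open>t\<close> makes it equal to -1.\<close>
        using expand[of "(q x + 1) / (2 * inner (T x) y)"] True by simp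
    qed
    then show ?thesis using True by simp
  next
    case False
    then have "0 < q y" using nonneg[of y] by simp
    then show ?thesis
      using expand[of "inner (T x) y / q y"] by (simp add: field_simps power2_eq_square)
  qed
qed

lemma kernel_eq: "q x = 0 \<longleftrightarrow> T x = 0"
proof
  assume "q x = 0"
  then have "(inner (T x) (T x))\<^sup>2 \<le> 0"
    using cauchy_schwarz[of x "T x"] by simp
  then show "T x = 0" by simp
qed simp

text \<open>Cauchy-Schwarz for the form, applied to \<open>x\<close> and \<open>T x\<close>,
  combined with boundedness of \<open>T\<close>. It makes \<open>T (x k)\<close> norm bounded when
  only \<open>q\<close> is controlled.\<close>

lemma norm_bound:
  obtains K where "0 \<le> K" "\<And>x. (norm (T x))\<^sup>2 \<le> K * q x"
proof -
  obtain K where K: "0 \<le> K" "\<And>x. norm (T x) \<le> norm x * K"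
    using nonneg_bounded by blast
  have "(norm (T x))\<^sup>2 \<le> K * q x" for x
  proof (cases "T x = 0")
    case False
    have "q (T x) \<le> norm (T (T x)) * norm (T x)"
      by (rule norm_cauchy_schwarz)
    also have "\<dots> \<le> (norm (T x) * K) * norm (T x)"
      by (intro mult_right_mono K) simp
    finally have "q (T x) \<le> K * (norm (T x))\<^sup>2"
      by (simp add: power2_eq_square mult_ac)
    then have "q x * q (T x) \<le> q x * (K * (norm (T x))\<^sup>2)"
      using nonneg by (intro mult_left_mono)
    moreover have "(norm (T x))\<^sup>2 * (norm (T x))\<^sup>2 \<le> q x * q (T x)"
      using cauchy_schwarz[of x "T x"] by (simp only: power2_norm_eq_inner flip: power2_eq_square)
    ultimately have "(norm (T x))\<^sup>2 * (norm (T x))\<^sup>2 \<le> (K * q x) * (norm (T x))\<^sup>2"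
      by (simp add: mult_ac)
    then show ?thesis
      by (rule mult_right_le_imp_le) (use False in simp)
  qed simp
  then show ?thesis using that K by blast
qed

lemma subspace_range: "subspace (range T)"
  by (rule linear_subspace_image[OF linear_axioms subspace_UNIV])

text \<open>A vector \<open>n\<close> orthogonal to the range is orthogonal to
  \<open>T (T n)\<close>, so by symmetry \<open>T n = 0\<close>; hence the component of
  \<open>b\<close> off the closed range vanishes.\<close>

lemma closure_range:
  assumes "\<And>n. T n = 0 \<Longrightarrow> inner b n = 0"
  shows "b \<in> closure (range T)"
proof -
  obtain w n where wn: "b = w + n" "w \<in> closure (range T)"
      "\<And>v. v \<in> closure (range T) \<Longrightarrow> inner n v = 0"
    using orthogonal_decomposition[OF subspace_closure[OF subspace_range] closed_closure] by metis
  have "inner n (T (T n)) = 0"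
    using wn(3) closure_subset by blast
  then have "T n = 0"
    using symmetric[of n "T n"] by simp
  then have "inner b n = 0"
    by (rule assms)
  then have "n = 0"
    using wn(3)[OF wn(2)] by (simp add: wn(1) inner_add_left inner_add_right inner_commute)
  then show ?thesis using wn by simp
qed

text \<open>
  The Cauchy-Schwarz inequality for the form of \<open>T\<close> avoids the operator square root: for \<open>b = T w\<close> it
  bounds \<open>(inner d b)\<^sup>2\<close> by \<open>q d * q w\<close>, and \<open>q w \<le> norm b * norm w\<close>.
\<close>

lemma range_lower_bound:
  assumes \<nu>: "0 < \<nu>" and below: "\<And>y. y \<in> range T \<Longrightarrow> \<nu> * norm y \<le> norm (T y)"
    and b: "\<And>n. T n = 0 \<Longrightarrow> inner b n = 0"
  shows "\<nu> * (inner d b)\<^sup>2 \<le> q d * (norm b)\<^sup>2"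
proof -
  have below': "\<nu> * norm y \<le> norm (T y)" if "y \<in> closure (range T)" for y
  proof -
    have "closure (range T) \<subseteq> {y. \<nu> * norm y \<le> norm (T y)}"
      using below by (intro closure_minimal closed_Collect_le continuous_intros continuous_on) auto
    then show ?thesis using that by blast
  qed
  have "range T \<subseteq> {b. \<nu> * (inner d b)\<^sup>2 \<le> q d * (norm b)\<^sup>2}"
  proof clarsimp
    fix y
    obtain w n where wn: "y = w + n" "w \<in> closure (range T)"
        "\<And>v. v \<in> closure (range T) \<Longrightarrow> inner n v = 0"
      \<comment> \<open>Passing from \<open>y\<close> to \<open>w\<close> keeps \<open>T y\<close>
        but gives a preimage to which the lower bound applies.\<close>
      using orthogonal_decomposition[OF subspace_closure[OF subspace_range] closed_closure] by metis
    have "inner n (T (T n)) = 0"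
      using wn(3) closure_subset by blast
    then have "T n = 0"
      using symmetric[of n "T n"] by simp
    then have Ty: "T y = T w" by (simp add: wn(1) add)
    have "\<nu> * (inner d (T w))\<^sup>2 \<le> \<nu> * (q d * q w)"
      using cauchy_schwarz[of d w] \<nu> by (simp add: symmetric)
    also have "\<dots> \<le> q d * (norm (T w) * (\<nu> * norm w))"
      using mult_left_mono[OF norm_cauchy_schwarz[of "T w" w], of "\<nu> * q d"] \<nu> nonneg[of d]
      by (simp add: mult_ac)
    also have "\<dots> \<le> q d * (norm (T w) * norm (T w))"
      using below'[OF wn(2)] nonneg by (intro mult_left_mono) auto
    finally show "\<nu> * (inner d (T y))\<^sup>2 \<le> q d * (norm (T y))\<^sup>2"
      by (simp add: Ty power2_eq_square)
  qed
  then have "closure (range T) \<subseteq> {b. \<nu> * (inner d b)\<^sup>2 \<le> q d * (norm b)\<^sup>2}"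
    by (intro closure_minimal closed_Collect_le continuous_intros)
  then show ?thesis
    using closure_range[OF b] by blast
qed

section \<open>Demiclosedness and Opial's lemma modulo the kernel\<close>

text \<open>Opial's argument in the seminorm: \<open>y k\<close> and \<open>v\<close> stand for the
  images of \<open>x k\<close> and \<open>u\<close> under a nonexpansive map, and weak convergence
  of \<open>T (x k)\<close> is all that the form sees.\<close>

lemma demiclosed:
  assumes weak: "weakly_converges (\<lambda>k. T (x k)) (T u)"
    and nonexp: "\<And>k. q (y k - v) \<le> q (x k - u)"
    and regular: "(\<lambda>k. q (x k - y k)) \<longlonglongrightarrow> 0"
    and bound: "\<And>k. q (x k - u) \<le> C"
  shows "T u = T v"
proof -
  \<comment> \<open>Expand \<open>q (x k - v)\<close> once through \<open>y k\<close> and once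
    through \<open>u\<close>; nonexpansiveness then removes the two large terms.\<close>
  have est: "q (u - v) \<le> q (x k - y k) + 2 * (sqrt (q (x k - y k)) * sqrt C)
               - 2 * inner (T (x k) - T u) (u - v)" for k
  proof -
    have "\<bar>inner (T (x k - y k)) (y k - v)\<bar> \<le> sqrt (q (x k - y k) * q (y k - v))"
      by (rule real_le_rsqrt) (simp add: cauchy_schwarz)
    also have "\<dots> \<le> sqrt (q (x k - y k) * C)"
      using nonexp[of k] bound[of k] nonneg[of "x k - y k"]
      by (intro real_sqrt_le_mono mult_left_mono) linarith+
    finally have "inner (T (x k - y k)) (y k - v) \<le> sqrt (q (x k - y k)) * sqrt C"
      by (simp add: real_sqrt_mult)
    moreover have "q (x k - v) = q (x k - y k) + 2 * inner (T (x k - y k)) (y k - v) + q (y k - v)"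
      using q_add[of "x k - y k" "y k - v"] by simp
    moreover have "q (x k - v) = q (x k - u) + 2 * inner (T (x k) - T u) (u - v) + q (u - v)"
      using q_add[of "x k - u" "u - v"] by (simp add: diff)
    ultimately show ?thesis using nonexp[of k] by linarith
  qed
  have "(\<lambda>k. inner (T (x k) - T u) (u - v)) \<longlonglongrightarrow> inner (T u) (u - v) - inner (T u) (u - v)"
    unfolding inner_diff_left[of _ _ "u - v"]
    using weak unfolding weakly_converges_def by (intro tendsto_diff tendsto_const) blast
  then have "(\<lambda>k. q (x k - y k) + 2 * (sqrt (q (x k - y k)) * sqrt C)
               - 2 * inner (T (x k) - T u) (u - v)) \<longlonglongrightarrow> 0 + 2 * (sqrt 0 * sqrt C) - 2 * 0"
    by (intro tendsto_intros regular) simp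
  then have "q (u - v) \<le> 0"
    using LIMSEQ_le_const[of _ 0 "q (u - v)"] est by auto
  then have "q (u - v) = 0" using nonneg[of "u - v"] by linarith
  then have "T (u - v) = 0" by (simp only: kernel_eq)
  then show ?thesis by (simp add: diff)
qed

text \<open>Bounded images have weak cluster points, each equal to some \<open>T z\<close> with
  \<open>z\<close> in \<open>Z\<close>; convergence of the distances to points of \<open>Z\<close>
  makes this image unique.\<close>

lemma fejer_weakly_converges:
  assumes closed: "closed (range T)" and "Z \<noteq> {}"
    and fejer: "\<And>z k. z \<in> Z \<Longrightarrow> q (x (Suc k) - z) \<le> q (x k - z)"
    and cluster: "\<And>r u. strict_mono r \<Longrightarrow> weakly_converges (\<lambda>k. T (x (r k))) (T u) \<Longrightarrow>
                    \<exists>z\<in>Z. T z = T u"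
  shows "\<exists>z\<in>Z. weakly_converges (\<lambda>k. T (x k)) (T z)"
proof -
  obtain z0 where z0: "z0 \<in> Z" using \<open>Z \<noteq> {}\<close> by blast
  obtain K where K: "0 \<le> K" "\<And>x. (norm (T x))\<^sup>2 \<le> K * q x"
    using norm_bound by blast
  have dec: "decseq (\<lambda>k. q (x k - z))" if "z \<in> Z" for z
    using fejer[OF that] by (rule decseq_SucI)
  have bdd: "norm (T (x k)) \<le> sqrt (K * q (x 0 - z0)) + norm (T z0)" for k
  proof -
    have "(norm (T (x k - z0)))\<^sup>2 \<le> K * q (x 0 - z0)"
      using K(2)[of "x k - z0"] mult_left_mono[OF decseqD[OF dec[OF z0], of 0 k] K(1)] by simp
    then have "norm (T (x k - z0)) \<le> sqrt (K * q (x 0 - z0))"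
      by (rule real_le_rsqrt)
    then show ?thesis
      using norm_triangle_ineq[of "T (x k - z0)" "T z0"] by (simp add: diff)
  qed
  have sub: "\<exists>s z. strict_mono s \<and> z \<in> Z \<and> weakly_converges (\<lambda>k. T (x (r (s k)))) (T z)"
    if r: "strict_mono r" for r :: "nat \<Rightarrow> nat"
  proof -
    obtain s l where s: "strict_mono s" "weakly_converges (\<lambda>k. T (x (r (s k)))) l"
      by (rule bounded_weakly_convergent_subsequence[of "\<lambda>k. T (x (r k))", OF bdd])
    have "l \<in> range T"
      by (rule weakly_converges_subspace[OF subspace_range closed s(2)]) simp
    then obtain u where u: "l = T u" by blast
    have "strict_mono (\<lambda>k. r (s k))"
      using r s(1) by (simp add: strict_mono_def)
    then obtain z where "z \<in> Z" "T z = T u"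
      using cluster s(2) u by metis
    then show ?thesis using s u by metis
  qed
  have unique: "T z = T z'"
    if z: "z \<in> Z" "strict_mono r" "weakly_converges (\<lambda>k. T (x (r k))) (T z)"
      and z': "z' \<in> Z" "strict_mono r'" "weakly_converges (\<lambda>k. T (x (r' k))) (T z')"
    for z z' and r r' :: "nat \<Rightarrow> nat"
  proof -
    have conv: "convergent (\<lambda>k. q (x k - w))" if "w \<in> Z" for w
      using decseq_convergent[OF dec[OF that], of 0] nonneg by (metis convergent_def)
    \<comment> \<open>Polarization writes the pairing through two convergent distances, so it has
      the same limit along both subsequences.\<close>
    have "inner (T (x k)) (z' - z) = (q (x k - z) - q (x k - z') - q z + q z') / 2" for k
      unfolding q_diff by (simp add: inner_diff_right)
    moreover obtain a b where "(\<lambda>k. q (x k - z)) \<longlonglongrightarrow> a" "(\<lambda>k. q (x k - z')) \<longlonglongrightarrow> b"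
      using conv[OF z(1)] conv[OF z'(1)] by (auto simp: convergent_def)
    then have "(\<lambda>k. (q (x k - z) - q (x k - z') - q z + q z') / 2) \<longlonglongrightarrow> (a - b - q z + q z') / 2"
      by (intro tendsto_divide tendsto_add tendsto_diff tendsto_const) simp_all
    ultimately obtain L where L: "(\<lambda>k. inner (T (x k)) (z' - z)) \<longlonglongrightarrow> L"
      by auto
    have "inner (T z) (z' - z) = L"
    proof (rule LIMSEQ_unique)
      show "(\<lambda>k. inner (T (x (r k))) (z' - z)) \<longlonglongrightarrow> inner (T z) (z' - z)"
        using z(3) by (simp add: weakly_converges_def)
    qed (use LIMSEQ_subseq_LIMSEQ[OF L z(2)] in \<open>simp add: o_def\<close>)
    moreover have "inner (T z') (z' - z) = L"
    proof (rule LIMSEQ_unique)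
      show "(\<lambda>k. inner (T (x (r' k))) (z' - z)) \<longlonglongrightarrow> inner (T z') (z' - z)"
        using z'(3) by (simp add: weakly_converges_def)
    qed (use LIMSEQ_subseq_LIMSEQ[OF L z'(2)] in \<open>simp add: o_def\<close>)
    ultimately have "q (z' - z) = 0"
      by (simp add: diff inner_diff_left)
    then have "T (z' - z) = 0" by (simp only: kernel_eq)
    then show ?thesis by (simp add: diff)
  qed
  obtain r z where r: "strict_mono r" and z: "z \<in> Z" "weakly_converges (\<lambda>k. T (x (r k))) (T z)"
    using sub[of "\<lambda>k. k"] by (auto simp: strict_mono_def)
  have "(\<lambda>k. inner (T (x k)) y) \<longlonglongrightarrow> inner (T z) y" for y
  proof (rule ccontr)
    \<comment> \<open>A subsequence staying \<open>e\<close> away would have a further one with weak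
      limit \<open>T z\<close>.\<close>
    assume "\<not> ?thesis"
    then obtain e where e: "0 < e"
        "\<And>N. \<exists>n\<ge>N. e \<le> dist (inner (T (x n)) y) (inner (T z) y)"
      unfolding lim_sequentially by (metis not_less)
    then have inf: "infinite {n. e \<le> dist (inner (T (x n)) y) (inner (T z) y)}"
      unfolding infinite_nat_iff_unbounded_le by blast
    obtain p :: "nat \<Rightarrow> nat" where p: "strict_mono p"
        "\<And>n. e \<le> dist (inner (T (x (p n))) y) (inner (T z) y)"
      using infinite_enumerate[OF inf] by auto
    obtain s z' where s: "strict_mono s" "z' \<in> Z" "weakly_converges (\<lambda>k. T (x (p (s k)))) (T z')"
      using sub[OF p(1)] by blast
    have "strict_mono (\<lambda>k. p (s k))"
      using p(1) s(1) by (simp add: strict_mono_def)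
    then have "T z' = T z"
      using unique[OF s(2) _ s(3) z(1) r z(2)] by blast
    then have "(\<lambda>k. inner (T (x (p (s k)))) y) \<longlonglongrightarrow> inner (T z) y"
      using s(3) by (simp add: weakly_converges_def)
    then obtain k where "dist (inner (T (x (p (s k)))) y) (inner (T z) y) < e"
      using e(1) unfolding lim_sequentially by blast
    then show False using p(2)[of "s k"] by linarith
  qed
  then show ?thesis using z(1) by (auto simp: weakly_converges_def)
qed

end

section \<open>The preconditioned forward-backward iteration\<close>

theorem theorem4p3:
  fixes A :: "'a::{real_inner, banach} \<Rightarrow> 'a set"
    and B Q M S Qt G :: "'a \<Rightarrow> 'a"
    and \<beta> \<nu> \<eta> :: real
    and x xt :: "nat \<Rightarrow> 'a"
  assumes Q: "bounded_linear Q"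
    and M: "bounded_linear M"
    and A: "maximally_monotone A"
    and \<beta>: "0 \<le> \<beta>"
    and B: "inverse_cocoercive \<beta> B"
    and ran_B: "range B \<subseteq> range Q"
    and M_inv: "invertible_operator M"
    and S_def: "S = (\<lambda>y. Q (inv M y))"
    and S_sa: "self_adjoint S"
    and S_psd: "positive_semidefinite S"
    and S_ker: "{y. S y = 0} - {0} \<noteq> {}"
    and Qt_def: "Qt = (\<lambda>y. (1/2) *\<^sub>R (Q y + adjoint Q y))"
    and Qt_psd: "positive_semidefinite Qt"
    and \<nu>: "0 < \<nu>"
    and Qt_closed_range: "\<forall>y\<in>range Qt. norm (Qt y) \<ge> \<nu> * norm y"
    and G_def: "G = (\<lambda>y. (1 - \<beta> / (4 * \<nu>)) *\<^sub>R (Q y + adjoint Q y) - adjoint M (Q y))"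
    and G_sa: "self_adjoint G"
    and G_psd: "positive_semidefinite G"
    and ran_AQ: "range (\<lambda>y. Q y - B y) \<subseteq> op_ran (\<lambda>y. A y + {Q y})"
    and zer_ne: "op_zer (\<lambda>y. A y + {B y}) \<noteq> {}"
    and step1: "\<And>k. 0 \<in> A (xt k) + {B (x k)} + {Q (xt k - x k)}"
    and step2: "\<And>k. x (Suc k) = x k + M (xt k - x k)"
    and \<eta>: "0 < \<eta>"
    and \<eta>_bound: "\<And>k. (op_seminorm (\<lambda>y. adjoint (inv M) (G (inv M y))) (x k - x (Suc k)))\<^sup>2
                     \<ge> \<eta> * (op_seminorm S (x k - x (Suc k)))\<^sup>2"
  shows "(\<exists>xs \<in> op_zer (\<lambda>y. A y + {B y}). weakly_converges (\<lambda>k. S (x k)) (S xs)) \<and>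
         (\<forall>xs \<in> op_zer (\<lambda>y. A y + {B y}). \<forall>k.
            op_seminorm S (x (Suc k) - x k)
              \<le> 1 / sqrt (real k + 1) * (1 / sqrt \<eta>) * op_seminorm S (x 0 - xs))"
proof -

  \<comment> \<open>Operators and quadratic forms\<close>
  define N where "N = inv M"
  have N: "bounded_linear N" and bijM: "bij M"
    using M_inv by (simp_all add: invertible_operator_def N_def)
  have MN: "M (N y) = y" and NM: "N (M y) = y" for y
    using bijM by (simp_all add: N_def bij_is_surj surj_f_inv_f bij_is_inj inv_f_f)
  have S_eq: "S y = Q (N y)" and SM: "S (M y) = Q y" for y
    by (simp_all add: S_def N_def[symmetric] NM)
  interpret Q: bounded_linear Q by fact
  interpret M: bounded_linear M by fact
  interpret N: bounded_linear N by fact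
  interpret aQ: bounded_linear "adjoint Q" by (rule bounded_linear_adjoint_hilbert[OF Q])
  note adjQ = adjoint_works_hilbert[OF Q] and adjM = adjoint_works_hilbert[OF M]
    and adjN = adjoint_works_hilbert[OF N]
  have "bounded_linear S"
    unfolding S_eq[abs_def] by (rule bounded_linear_compose[OF Q N])
  then interpret S: psd_operator S
    using S_psd S_sa adjoint_works_hilbert[of S]
    by (auto simp: psd_operator_def psd_operator_axioms_def positive_semidefinite_def
        self_adjoint_def)
  have "bounded_linear Qt"
    unfolding Qt_def by (intro bounded_linear_intros Q aQ.bounded_linear_axioms)
  moreover have "inner (Qt y) z = inner y (Qt z)" for y z
    using adjQ[of y z] adjQ[of z y]
    by (simp add: Qt_def inner_add_left inner_add_right inner_commute)
  ultimately interpret Qt: psd_operator Qt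
    using Qt_psd by (auto simp: psd_operator_def psd_operator_axioms_def positive_semidefinite_def)
  have qQt: "inner (Qt y) y = inner (Q y) y" for y
    using adjQ[of y y] by (simp add: Qt_def inner_add_right inner_commute)
  \<comment> \<open>\<open>Q\<close> and its adjoint have the same form, and
    \<open>S (M y) = Q y\<close> turns the last term of \<open>G\<close> into
    \<open>S.q (M y)\<close>.\<close>
  have qG: "inner (G y) y = 2 * inner (Q y) y - \<beta> / (2 * \<nu>) * inner (Q y) y - S.q (M y)" for y
  proof -
    have "inner (G y) y = (1 - \<beta> / (4 * \<nu>)) * (inner (Q y) y + inner (adjoint Q y) y)
        - inner (adjoint M (Q y)) y"
      by (simp add: G_def inner_diff_left inner_add_left)
    also have "inner (adjoint Q y) y = inner (Q y) y"
      using adjQ[of y y] by (simp add: inner_commute)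
    also have "inner (adjoint M (Q y)) y = S.q (M y)"
      using adjM[of y "Q y"] by (simp add: SM inner_commute)
    finally show ?thesis using \<nu> by (simp add: field_simps)
  qed
  have G0: "0 \<le> inner (G y) y" for y
    using G_psd by (simp add: positive_semidefinite_def)

  \<comment> \<open>The common kernel\<close>
  have kerQ: "Q y = 0 \<and> adjoint Q y = 0" if "inner (Q y) y = 0" for y
  proof -
    \<comment> \<open>Where the form of \<open>Q\<close> vanishes, positivity of \<open>G\<close>
      leaves only the term \<open>- S.q (M y)\<close>.\<close>
    have "S.q (M y) \<le> 0"
      using G0[of y] by (simp add: qG that)
    then have "S (M y) = 0"
      using S.nonneg[of "M y"] S.kernel_eq[of "M y"] by linarith
    then have Q0: "Q y = 0" by (simp add: SM)
    moreover have "Qt y = 0"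
      using that Qt.kernel_eq[of y] by (simp add: qQt)
    ultimately show ?thesis by (simp add: Qt_def)
  qed
  have kerQt_eq: "Qt y = 0 \<longleftrightarrow> Q y = 0" for y
    using Qt.kernel_eq[of y] kerQ[of y] by (auto simp: qQt)
  have kerS: "S y = 0" if "Q y = 0" for y
  proof -
    have "adjoint Q y = 0" using kerQ[of y] that by simp
    \<comment> \<open>The range of \<open>S\<close> lies in that of \<open>Q\<close>, which is
      orthogonal to the kernel of \<open>adjoint Q\<close>.\<close>
    then have "inner (S z) y = 0" for z
      using adjQ[of "N z" y] by (simp add: S_eq)
    then show ?thesis
      using S.symmetric[of y "S y"] by (simp add: inner_commute)
  qed
  have ran_perp: "inner (Q z) n = 0" if "Q n = 0" for z n
    using kerQ[of n] adjQ[of z n] that by simp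

  \<comment> \<open>Coercivity and the closed range of \<open>S\<close>\<close>
  have below: "\<nu> * (inner d b)\<^sup>2 \<le> inner (Q d) d * (norm b)\<^sup>2"
    if "\<And>n. Q n = 0 \<Longrightarrow> inner b n = 0" for d b
    using Qt.range_lower_bound[OF \<nu>, of b d] Qt_closed_range that by (simp add: qQt kerQt_eq)
  have "closed (range Q)"
  proof (rule closed_range_bounded_below[OF Q \<nu>])
    fix z assume perp: "\<And>n. Q n = 0 \<Longrightarrow> inner z n = 0"
    show "\<nu> * norm z \<le> norm (Q z)"
    proof (cases "z = 0")
      case False
      \<comment> \<open>Both arguments of \<open>below\<close> are \<open>z\<close> here; in
        \<open>coc\<close> the second is a difference of values of \<open>B\<close>.\<close>
      have "\<nu> * (norm z)\<^sup>2 * (norm z)\<^sup>2 \<le> inner (Q z) z * (norm z)\<^sup>2"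
        using below[OF perp, of z]
        by (simp add: power2_norm_eq_inner power2_eq_square[of "inner z z"] mult_ac)
      then have "\<nu> * (norm z)\<^sup>2 \<le> inner (Q z) z"
        using False by simp
      also have "\<dots> \<le> norm (Q z) * norm z"
        by (rule norm_cauchy_schwarz)
      finally show ?thesis
        using False by (simp add: power2_eq_square flip: mult.assoc)
    qed simp
  qed
  moreover have "range S = range Q"
    unfolding S_eq using surj_def[of N] NM by (metis (no_types) image_image rangeI surj_def)
  ultimately have clS: "closed (range S)" by simp

  \<comment> \<open>Cocoercivity and nonexpansiveness of one step\<close>
  have B_perp: "inner (B y - B z) n = 0" if "Q n = 0" for y z n
  proof -
    obtain y' z' where "B y = Q y'" "B z = Q z'"
      using ran_B by blast
    then show ?thesis
      using ran_perp[OF that, of "y' - z'"] by (simp add: Q.diff)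
  qed
  have coc: "- inner (y - z) (B y - B z) - inner d (B y - B z) \<le> \<beta> / (4 * \<nu>) * inner (Q d) d"
    for y z d
  proof (cases "\<beta> = 0")
    case True
    then show ?thesis using B by (simp add: inverse_cocoercive_def)
  next
    case False
    then have b: "0 < \<beta>" using \<beta> by simp
    define n where "n = norm (B y - B z)"
    define r where "r = inner (Q d) d"
    have "\<nu> * (inner d (B y - B z))\<^sup>2 \<le> r * n\<^sup>2"
      unfolding r_def n_def by (rule below[OF B_perp])
    moreover have r0: "0 \<le> r" unfolding r_def qQt[symmetric] by (rule Qt.nonneg)
    ultimately have "(inner d (B y - B z))\<^sup>2 \<le> (sqrt (r / \<nu>) * n)\<^sup>2"
      using \<nu> by (simp add: power_mult_distrib field_simps)
    then have "- inner d (B y - B z) \<le> sqrt (r / \<nu>) * n"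
      using r0 \<nu> by (intro power2_le_imp_le[of "- inner d (B y - B z)"])
        (auto simp: n_def intro: abs_le_D2 power2_le_imp_le)
    moreover have "n\<^sup>2 / \<beta> \<le> inner (y - z) (B y - B z)"
      using B False by (simp add: inverse_cocoercive_def cocoercive_def n_def divide_inverse mult.commute)
    moreover have "sqrt (r / \<nu>) * n \<le> n\<^sup>2 / \<beta> + \<beta> / (4 * \<nu>) * r"
    proof -
      \<comment> \<open>Young's inequality, weighted so that cocoercivity absorbs
        \<open>n\<^sup>2 / \<beta>\<close>; what remains is half of the \<beta>-term in
        \<open>qG\<close>.\<close>
      have "0 \<le> (n - \<beta> / 2 * sqrt (r / \<nu>))\<^sup>2 / \<beta>"
        using b by simp
      also have "\<dots> = n\<^sup>2 / \<beta> - sqrt (r / \<nu>) * n + \<beta> / 4 * (sqrt (r / \<nu>))\<^sup>2"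
        using b by (simp add: power2_eq_square field_simps)
      finally show ?thesis using r0 \<nu> by simp
    qed
    ultimately show ?thesis unfolding r_def by linarith
  qed

  \<comment> \<open>Here \<open>d\<close> is the displacement from \<open>y\<close> to a solution of
    the inclusion at \<open>y\<close>. A relation is used, as no uniqueness of \<open>d\<close> is
    assumed.\<close>
  define step where "step y d \<longleftrightarrow> - B y - Q d \<in> A (y + d)" for y d
  have nonexp: "S.q (y + M d - (z + M e)) \<le> S.q (y - z) - inner (G (d - e)) (d - e)"
    if "step y d" "step z e" for y z d e
  proof -
    define w where "w = d - e"
    have "0 \<le> inner ((y + d) - (z + e)) ((- B y - Q d) - (- B z - Q e))"
      using A that unfolding maximally_monotone_def monotone_operator_def step_def by blast
    also have "(y + d) - (z + e) = (y - z) + w"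
      by (simp add: w_def)
    also have "(- B y - Q d) - (- B z - Q e) = - (B y - B z) - Q w"
      by (simp add: w_def Q.diff)
    also have "inner ((y - z) + w) (- (B y - B z) - Q w) = - inner (y - z) (B y - B z)
        - inner w (B y - B z) - (inner (Q w) (y - z) + inner (Q w) w)"
      by (simp only: inner_add_left inner_diff_right[of _ "- (B y - B z)"] inner_minus_right
          inner_commute[of "Q w"])
    finally have "inner (Q w) (y - z) + inner (Q w) w \<le> \<beta> / (4 * \<nu>) * inner (Q w) w"
      using coc[of y z w] by linarith
    \<comment> \<open>Since \<open>S (M w) = Q w\<close>, the cross term is the one just bounded by
      monotonicity, and the remaining terms form \<open>- inner (G w) w\<close>.\<close>
    moreover have "S.q (y - z + M w) = S.q (y - z) + 2 * inner (Q w) (y - z) + S.q (M w)"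
      using S.symmetric[of "y - z" "M w"] S.q_add[of "y - z" "M w"]
      by (simp add: SM inner_commute[of "y - z"])
    moreover have shift: "y + M d - (z + M e) = y - z + M w"
      by (simp add: w_def M.diff)
    have "S.q (y + M d - (z + M e)) = S.q (y - z + M w)"
      by (simp only: shift)
    moreover have "\<beta> / (2 * \<nu>) * inner (Q w) w = 2 * (\<beta> / (4 * \<nu>) * inner (Q w) w)"
      by simp
    ultimately show ?thesis
      unfolding qG w_def[symmetric] by linarith
  qed

  \<comment> \<open>Iterates, zeros and arbitrary points as starting points of steps\<close>
  have step_x: "step (x k) (xt k - x k)" for k
  proof -
    obtain a where "a \<in> A (xt k)" "0 = a + B (x k) + Q (xt k - x k)"
      using step1[of k] by (auto simp: set_plus_def)
    moreover from this(2) have "a = - B (x k) - Q (xt k - x k)"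
      by (simp add: algebra_simps eq_neg_iff_add_eq_0)
    ultimately show ?thesis by (simp add: step_def)
  qed
  have zer_iff: "z \<in> op_zer (\<lambda>y. A y + {B y}) \<longleftrightarrow> - B z \<in> A z" for z
  proof -
    have "0 = a + B z \<longleftrightarrow> a = - B z" for a
      by (auto simp: eq_neg_iff_add_eq_0)
    then show ?thesis by (auto simp: op_zer_def set_plus_def)
  qed
  define Z where "Z = op_zer (\<lambda>y. A y + {B y})"
  \<comment> \<open>A zero admits the step with no displacement, so it can be compared with the
    iterates.\<close>
  have step_zer: "step z 0" if "z \<in> Z" for z
    using that by (simp add: step_def Z_def zer_iff)
  have step_ex: "\<exists>d. step u d" for u
  proof -
    have "Q u - B u \<in> op_ran (\<lambda>y. A y + {Q y})"
      using ran_AQ by blast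
    then obtain y a where "a \<in> A y" "Q u - B u = a + Q y"
      by (auto simp: op_ran_def set_plus_def)
    moreover from this(2) have "a = - B u - Q (y - u)"
      by (simp add: Q.diff algebra_simps)
    ultimately show ?thesis by (intro exI[of _ "y - u"]) (simp add: step_def)
  qed

  \<comment> \<open>Fejer monotonicity and the rate\<close>
  have decrease: "S.q (x (Suc k) - x k) * \<eta> \<le> inner (G (xt k - x k)) (xt k - x k)" for k
  proof -
    have e: "x k - x (Suc k) = M (x k - xt k)"
      by (simp add: step2 M.diff)
    \<comment> \<open>Moving \<open>adjoint N\<close> across the inner product and cancelling
      \<open>M\<close> returns the form of \<open>G\<close> at the displacement.\<close>
    have "inner (adjoint N (G (N (x k - x (Suc k))))) (x k - x (Suc k))
        = inner (G (x k - xt k)) (x k - xt k)"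
      using adjN[of "x k - x (Suc k)" "G (x k - xt k)"] by (simp add: e NM inner_commute)
    moreover have "inner (G (- y)) (- y) = inner (G y) y" for y
      unfolding qG M.neg Q.neg S.q_minus by simp
    from this[of "x k - xt k"]
    have "inner (G (x k - xt k)) (x k - xt k) = inner (G (xt k - x k)) (xt k - x k)"
      by simp
    moreover have "S.q (x k - x (Suc k)) = S.q (x (Suc k) - x k)"
      using S.q_minus[of "x k - x (Suc k)"] by simp
    ultimately show ?thesis
      using \<eta>_bound[of k] G0 S.nonneg by (simp add: op_seminorm_def N_def[symmetric] mult.commute)
  qed
  have fejer: "S.q (x (Suc k) - z) \<le> S.q (x k - z) - S.q (x (Suc k) - x k) * \<eta>" if "z \<in> Z" for z k
    using nonexp[OF step_x[of k] step_zer[OF that]] decrease[of k]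
    by (simp add: step2[of k] M.zero)
  have fejer': "S.q (x (Suc k) - z) \<le> S.q (x k - z)" if "z \<in> Z" for z k
  proof -
    have "0 \<le> S.q (x (Suc k) - x k) * \<eta>"
      using \<eta> by (intro mult_nonneg_nonneg S.nonneg) simp
    then show ?thesis using fejer[OF that, of k] by linarith
  qed
  have dec: "decseq (\<lambda>k. S.q (x k - z))" if "z \<in> Z" for z
    using fejer'[OF that] by (rule decseq_SucI)
  \<comment> \<open>Nonexpansiveness applied to two consecutive iterates: step lengths never
    grow.\<close>
  have diffs: "S.q (x (Suc (Suc k)) - x (Suc k)) \<le> S.q (x (Suc k) - x k)" for k
    using nonexp[OF step_x[of "Suc k"] step_x[of k]] G0[of "xt (Suc k) - x (Suc k) - (xt k - x k)"]
    unfolding step2[of "Suc k", symmetric] step2[of k, symmetric] by linarith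
  \<comment> \<open>The first \<open>n\<close> decreases are each at least the one at index
    \<open>n\<close>, so \<open>n\<close> copies of the latter replace their sum.\<close>
  have sum_bound: "real n * (S.q (x (Suc n) - x n) * \<eta>) + S.q (x n - z) \<le> S.q (x 0 - z)"
    if "z \<in> Z" for z n
  proof (induction n)
    case (Suc n)
    have "real (Suc n) * (S.q (x (Suc (Suc n)) - x (Suc n)) * \<eta>)
        \<le> real (Suc n) * (S.q (x (Suc n) - x n) * \<eta>)"
      using diffs[of n] \<eta> by (intro mult_left_mono mult_right_mono) auto
    then show ?case
      using fejer[OF that, of n] Suc by (simp add: algebra_simps)
  qed simp
  have rate: "S.q (x (Suc n) - x n) \<le> S.q (x 0 - z) / \<eta> / (real n + 1)" if "z \<in> Z" for z n
  proof -
    \<comment> \<open>The decrease from \<open>x n\<close> to \<open>x (Suc n)\<close> supplies the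
      extra copy.\<close>
    have "(real n + 1) * (S.q (x (Suc n) - x n) * \<eta>) \<le> S.q (x 0 - z)"
      using sum_bound[OF that, of n] fejer[OF that, of n] S.nonneg[of "x (Suc n) - z"]
      by (simp add: algebra_simps)
    moreover have "a \<le> b / \<eta> / c" if "c * (a * \<eta>) \<le> b" "0 < c" for a b c
      using that \<eta> by (simp add: pos_le_divide_eq mult_ac)
    ultimately show ?thesis by simp
  qed

  \<comment> \<open>Weak convergence\<close>
  obtain z0 where z0: "z0 \<in> Z" using zer_ne by (auto simp: Z_def)
  have regular: "(\<lambda>k. S.q (x (Suc k) - x k)) \<longlonglongrightarrow> 0"
  proof (rule tendsto_sandwich[where f = "\<lambda>_. 0"])
    have "(\<lambda>k. c / (real k + 1)) \<longlonglongrightarrow> 0" for c :: real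
      using tendsto_mult_right_zero[OF LIMSEQ_inverse_real_of_nat, of c]
      by (simp add: divide_inverse add.commute)
    then show "(\<lambda>k. S.q (x 0 - z0) / \<eta> / (real k + 1)) \<longlonglongrightarrow> 0" .
  qed (intro always_eventually allI S.nonneg rate[OF z0] tendsto_const)+
  \<comment> \<open>The parallelogram law for the form; \<open>u\<close> is only a candidate cluster
    point, so Fejer monotonicity is used at \<open>z0\<close>.\<close>
  have bound: "S.q (x k - u) \<le> 2 * S.q (x 0 - z0) + 2 * S.q (z0 - u)" for k u
  proof -
    have "S.q (x k - z0) \<le> S.q (x 0 - z0)"
      using decseqD[OF dec[OF z0], of 0 k] by simp
    moreover have "S.q (x k - u) + S.q ((x k - z0) - (z0 - u)) = 2 * S.q (x k - z0) + 2 * S.q (z0 - u)"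
      using S.q_add[of "x k - z0" "z0 - u"] S.q_diff[of "x k - z0" "z0 - u"] by simp
    ultimately show ?thesis
      using S.nonneg[of "(x k - z0) - (z0 - u)"] by linarith
  qed
  have "\<exists>z\<in>Z. weakly_converges (\<lambda>k. S (x k)) (S z)"
  proof (rule S.fejer_weakly_converges[OF clS])
    show "Z \<noteq> {}" using z0 by blast
  next
    fix z k assume "z \<in> Z"
    then show "S.q (x (Suc k) - z) \<le> S.q (x k - z)"
      by (rule fejer')
  next
    fix r u assume r: "strict_mono (r :: nat \<Rightarrow> nat)"
      and weak: "weakly_converges (\<lambda>k. S (x (r k))) (S u)"
    obtain d where d: "step u d" using step_ex by blast
    \<comment> \<open>Demiclosedness with \<open>x (r k)\<close> moving to
      \<open>x (Suc (r k))\<close> and \<open>u\<close> to \<open>u + M d\<close>.\<close>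
    have "S u = S (u + M d)"
    proof (rule S.demiclosed[OF weak])
      show "S.q (x (Suc (r k)) - (u + M d)) \<le> S.q (x (r k) - u)" for k
        using nonexp[OF step_x[of "r k"] d] G0[of "xt (r k) - x (r k) - d"]
        unfolding step2[of "r k", symmetric] by linarith
      have "S.q (x (r k) - x (Suc (r k))) = S.q (x (Suc (r k)) - x (r k))" for k
        using S.q_minus[of "x (r k) - x (Suc (r k))"] by simp
      then show "(\<lambda>k. S.q (x (r k) - x (Suc (r k)))) \<longlonglongrightarrow> 0"
        using LIMSEQ_subseq_LIMSEQ[OF regular r] by (simp add: o_def)
    qed (rule bound)
    then have Qd: "Q d = 0" by (simp add: S.add SM)
    \<comment> \<open>Differences of values of \<open>B\<close> are orthogonal to \<open>d\<close>,
      so cocoercivity forces this one to vanish.\<close>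
    have "B (u + d) = B u"
    proof (cases "\<beta> = 0")
      case False
      then have "cocoercive (inverse \<beta>) B"
        using B by (simp add: inverse_cocoercive_def)
      then have "inverse \<beta> * (norm (B (u + d) - B u))\<^sup>2 \<le> inner (u + d - u) (B (u + d) - B u)"
        unfolding cocoercive_def by blast
      also have "\<dots> = 0"
        using B_perp[OF Qd, of "u + d" u] by (simp add: inner_commute)
      finally show ?thesis
        using False \<beta> by (simp add: mult_le_0_iff)
    qed (use B in \<open>simp add: inverse_cocoercive_def\<close>)
    then have "u + d \<in> Z"
      using d Qd by (simp add: Z_def zer_iff step_def)
    moreover have "S (u + d) = S u"
      using kerS[OF Qd] by (simp add: S.add)
    ultimately show "\<exists>z\<in>Z. S z = S u" by blast
  qed
  moreover have "op_seminorm S (x (Suc k) - x k)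
      \<le> 1 / sqrt (real k + 1) * (1 / sqrt \<eta>) * op_seminorm S (x 0 - z)" if "z \<in> Z" for z k
    using real_sqrt_le_mono[OF rate[OF that, of k]]
    by (simp add: op_seminorm_def real_sqrt_divide real_sqrt_mult mult.commute)
  ultimately show ?thesis by (simp add: Z_def)
qed

end
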